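(* Let $E:[0,T]\times\mathbb{R}^m\rightrightarrows\mathbb{R}^m$ be a set-valued map such that: (E1) $E(t,z)$ is nonempty, closed and convex for all $(t,z)$; (E6) $(t,z)\mapsto E(t,z)$ has closed graph and is lower semicontinuous; (ELC) for every $R>0$ there is an integrable $k_R:[0,T]\to[0,\infty)$ with $E(t,x)\subset E(t,y)+k_R(t)|x-y|(\bar B^{m-1}\times[-1,1])$ for all $t\in[0,T]$, $x,y\in\bar B_R$. Let $P:[0,T]\rightrightarrows\mathbb{R}^m$ have closed graph and nonempty values, and assume $$\forall t\in(0,T),\ \forall z\in P(t):\quad \{1\}\times E(t,z)\subset\overline{\mathrm{conv}}\big(T_{\mathrm{gph}\,P}(t,z)\big).$$ Then for all $t_0\in(0,T)$ and $z_0\in P(t_0)$, every absolutely continuous $z:[t_0,T]\to\mathbb{R}^m$ with $\dot z(t)\in E(t,z(t))$ a.e. and $z(t_0)=z_0$ satisfies $z(t)\in P(t)$ for all $t\in[t_0,T]$.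
   Context: $\bar B_R$ is the closed ball of radius $R$ about $0$ in $\mathbb{R}^m$; $\bar B^{m-1}$ is the closed unit ball of $\mathbb{R}^{m-1}$, and $\mathbb{R}^m$ is identified with $\mathbb{R}^{m-1}\times\mathbb{R}$. A set-valued map $F$ is lower semicontinuous if for every open $U$ the set $\{z:F(z)\cap U\ne\emptyset\}$ is open. $\mathrm{gph}\,P=\{(t,z):z\in P(t)\}$. For $K\subset\mathbb{R}^k$ and $w\in K$, the contingent cone is $T_K(w)=\{v:\liminf_{\tau\to0^+}d(w+\tau v,K)/\tau=0\}$, with $d$ the Euclidean distance to a set. $\overline{\mathrm{conv}}$ denotes closed convex hull. *)

theory Defs
  imports "HOL-Analysis.Analysis"
begin

definition contingent_cone :: "'a::real_normed_vector set \<Rightarrow> 'a \<Rightarrow> 'a set" where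
  "contingent_cone K w =
     {v. Liminf (at_right (0::real)) (\<lambda>\<tau>. ereal (infdist (w + \<tau> *\<^sub>R v) K / \<tau>)) = 0}"

definition lsc_on :: "'a::topological_space set \<Rightarrow> ('a \<Rightarrow> 'b::topological_space set) \<Rightarrow> bool" where
  "lsc_on S F \<longleftrightarrow> (\<forall>U. open U \<longrightarrow> openin (top_of_set S) {x\<in>S. F x \<inter> U \<noteq> {}})"

definition abs_continuous_on :: "real set \<Rightarrow> (real \<Rightarrow> 'a::real_normed_vector) \<Rightarrow> bool" where
  "abs_continuous_on S f \<longleftrightarrow>
    (\<forall>\<epsilon>>0. \<exists>\<delta>>0. \<forall>(n::nat) (a::nat \<Rightarrow> real) b.
       (\<forall>i<n. a i \<le> b i \<and> {a i..b i} \<subseteq> S) \<and>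
       (\<forall>i<n. \<forall>j<n. i \<noteq> j \<longrightarrow> b i \<le> a j \<or> b j \<le> a i) \<and>
       (\<Sum>i<n. b i - a i) < \<delta>
       \<longrightarrow> (\<Sum>i<n. norm (f (b i) - f (a i))) < \<epsilon>)"

text \<open>The set (closed unit ball of R^(m-1)) x [-1,1] inside R^m, where the
  coordinate j plays the role of the last (R) factor.\<close>
definition cyl_box :: "'n::finite \<Rightarrow> (real^'n) set" where
  "cyl_box j = {v. sqrt (\<Sum>i\<in>UNIV - {j}. (v $ i)\<^sup>2) \<le> 1 \<and> \<bar>v $ j\<bar> \<le> 1}"

end

theory Submission
  imports Defs
begin

text \<open>
  Let \<open>K\<close> be the graph of \<open>P\<close>. A proximal normal to \<open>K\<close> is polar to the contingent cone, hence also
  to its closed convex hull; with lower semicontinuity of \<open>E\<close> this shows that the distance to \<open>K\<close>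
  along a ray with direction \<open>(1, v)\<close>, \<open>v \<in> E t w\<close>, is \<open>o(h)\<close>. So from every \<open>(t, w) \<in> K\<close> one can move
  inside \<open>K\<close> to a slightly later time with velocity close to \<open>v\<close>.

  Compare \<open>z\<close> with such moves. If \<open>z t\<close> is at distance \<open>r\<close> from \<open>w \<in> P t\<close> and \<open>z\<close> solves the inclusion
  at \<open>t\<close>, the Lipschitz condition gives \<open>v\<close> with \<open>norm (z' t - v) \<le> 2 * k t * r\<close>; at the remaining times,
  a null set, any \<open>v\<close> of bounded norm will do. The distance from \<open>z\<close> to \<open>P\<close> thus stays below a Gronwall
  bound \<open>exp (A t) * (e * (t - t0) + m t)\<close>, where the monotone function \<open>A\<close> is a Perron majorant of
  \<open>2 * k\<close> and the monotone function \<open>m \<le> e\<close> pays for the null set. As \<open>P\<close> has closed graph the bound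
  persists under limits from the left, and \<open>e\<close> is arbitrary.
\<close>

subsection \<open>Rays and contingent cones\<close>

text \<open>The supremum of the points of \<open>{a..b}\<close> where \<open>Q\<close> holds
  satisfies \<open>Q\<close> by \<open>lim\<close>, and \<open>step\<close> prevents it from lying
  below \<open>b\<close>. \<open>Q\<close> may fail in between, which suits moves that jump forward
  in time.\<close>

lemma real_closed_induct:
  fixes a b :: real
  assumes "a \<le> b" "Q a"
    and step: "\<And>t. a \<le> t \<Longrightarrow> t < b \<Longrightarrow> Q t \<Longrightarrow> \<exists>s>t. s \<le> b \<and> Q s"
    and lim: "\<And>f t. (\<And>n::nat. a \<le> f n \<and> f n \<le> t \<and> Q (f n)) \<Longrightarrow> f \<longlonglongrightarrow> t \<Longrightarrow> t \<le> b \<Longrightarrow> Q t"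
  shows "Q b"
proof -
  define S where "S = {t \<in> {a..b}. Q t}"
  have S: "S \<noteq> {}" "bdd_above S"
    using assms(1,2) by (auto simp: S_def intro: bdd_aboveI[of _ b])
  from closure_contains_Sup[OF S] obtain f where f: "\<And>n. f n \<in> S" "f \<longlonglongrightarrow> Sup S"
    unfolding closure_sequential by blast
  have "Sup S \<le> b"
    using S by (intro cSup_least) (auto simp: S_def)
  have "Q (Sup S)"
    using f cSup_upper[OF _ S(2)] by (intro lim[OF _ f(2) \<open>Sup S \<le> b\<close>]) (auto simp: S_def)
  moreover have "a \<le> Sup S"
    using assms(1,2) by (intro cSup_upper S) (auto simp: S_def)
  moreover have "\<not> Sup S < b"
  proof
    assume "Sup S < b"
    then obtain s where "s > Sup S" "s \<le> b" "Q s"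
      using step \<open>Q (Sup S)\<close> \<open>a \<le> Sup S\<close> by blast
    then have "s \<in> S" using \<open>a \<le> Sup S\<close> by (simp add: S_def)
    then show False using cSup_upper[OF _ S(2)] \<open>s > Sup S\<close> by fastforce
  qed
  ultimately show ?thesis using \<open>Sup S \<le> b\<close> by force
qed

lemma infdist_attained:
  fixes K :: "'a::heine_borel set"
  assumes "closed K" "K \<noteq> {}"
  obtains x where "x \<in> K" "infdist y K = dist y x"
proof -
  obtain x where "x \<in> K" "\<forall>k\<in>K. dist y x \<le> dist y k"
    using distance_attains_inf[OF assms] by metis
  then have "infdist y K = dist y x"
    using assms(2) by (intro antisym infdist_le) (auto simp: infdist_def intro!: cINF_greatest)
  then show ?thesis using that \<open>x \<in> K\<close> by blast
qed

text \<open>A proximal normal is polar to the contingent cone: the open ball about \<open>y\<close>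
  of radius \<open>dist y x\<close> misses \<open>K\<close>, whereas a small move from
  \<open>x\<close> along a \<open>u\<close> with \<open>(y - x) \<bullet> u > 0\<close> would enter
  it, even after a correction that is small relative to the step.\<close>

lemma inner_contingent_cone_nonpos:
  fixes K :: "'a::euclidean_space set"
  assumes "closed K" "x \<in> K" and nearest: "infdist y K = dist y x"
    and u: "u \<in> contingent_cone K x"
  shows "(y - x) \<bullet> u \<le> 0"
proof (rule ccontr)
  assume pos: "\<not> (y - x) \<bullet> u \<le> 0"
  define p where "p = y - x"
  define c where "c = p \<bullet> u"
  have "c > 0" using pos by (simp add: c_def p_def)
  \<comment> \<open>With this \<open>e\<close>, an error of norm at most \<open>\<tau> * e\<close>
    changes the inner product with \<open>p\<close> by at most half of the gain
    \<open>\<tau> * c\<close>.\<close>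
  define e where "e = c / (2 * (norm p + 1))"
  have "e > 0" using \<open>c > 0\<close> by (simp add: e_def add_nonneg_pos)
  have pe: "norm p * e \<le> c / 2"
  proof -
    have "norm p + 1 > 0" by (simp add: add_nonneg_pos)
    then have "e * (2 * (norm p + 1)) = c" by (simp add: e_def del: distrib_left_numeral)
    then show ?thesis using \<open>e > 0\<close> by (simp add: algebra_simps)
  qed
  \<comment> \<open>A vanishing liminf makes the quotient small only frequently; this is then
    combined with conditions that hold eventually.\<close>
  have "\<not> (\<forall>\<^sub>F \<tau> in at_right (0::real). ereal e \<le> ereal (infdist (x + \<tau> *\<^sub>R u) K / \<tau>))"
  proof
    assume "\<forall>\<^sub>F \<tau> in at_right (0::real). ereal e \<le> ereal (infdist (x + \<tau> *\<^sub>R u) K / \<tau>)"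
    from Liminf_bounded[OF this] show False
      using u \<open>e > 0\<close> by (simp add: contingent_cone_def)
  qed
  moreover have "\<forall>\<^sub>F \<tau> in at_right (0::real). \<tau> * (norm u + e)\<^sup>2 < c"
  proof -
    have "((\<lambda>\<tau>::real. \<tau> * (norm u + e)\<^sup>2) \<longlongrightarrow> 0 * (norm u + e)\<^sup>2) (at_right 0)"
      by (intro tendsto_intros)
    from order_tendstoD(2)[OF this, of c] \<open>c > 0\<close> show ?thesis by simp
  qed
  moreover note eventually_at_right_less[of "0::real"]
  ultimately have "\<exists>\<^sub>F \<tau> in at_right (0::real). infdist (x + \<tau> *\<^sub>R u) K / \<tau> < e \<and>
      (\<tau> * (norm u + e)\<^sup>2 < c \<and> 0 < \<tau>)"
    by (intro frequently_eventually_frequently eventually_conj) (auto simp: frequently_def not_less)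
  then obtain \<tau> where \<tau>: "\<tau> > 0" "infdist (x + \<tau> *\<^sub>R u) K / \<tau> < e" "\<tau> * (norm u + e)\<^sup>2 < c"
    using frequently_ex by blast
  obtain k where k: "k \<in> K" "infdist (x + \<tau> *\<^sub>R u) K = dist (x + \<tau> *\<^sub>R u) k"
    using infdist_attained assms by (metis empty_iff)
  define q where "q = k - x - \<tau> *\<^sub>R u"
  have q: "norm q \<le> \<tau> * e"
    using \<tau> k by (simp add: q_def dist_norm field_simps norm_minus_commute)
  have kx: "k - x = \<tau> *\<^sub>R u + q" by (simp add: q_def)
  have "norm (k - x) \<le> \<tau> * (norm u + e)"
    using norm_triangle_ineq[of "\<tau> *\<^sub>R u" q] q \<tau>(1) by (simp add: kx algebra_simps)
  then have n2: "(norm (k - x))\<^sup>2 \<le> \<tau> * (\<tau> * (norm u + e)\<^sup>2)"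
    using power_mono[of "norm (k - x)" "\<tau> * (norm u + e)" 2] by (simp add: power2_eq_square mult_ac)
  \<comment> \<open>\<open>k\<close> is no closer to \<open>y\<close> than the nearest point
    \<open>x\<close>. Expanding the squares bounds \<open>p \<bullet> (k - x)\<close> by a
    second-order quantity, against its first-order part \<open>\<tau> * c\<close>.\<close>
  have "norm p \<le> norm (p - (k - x))"
    using infdist_le[OF k(1), of y] by (simp add: nearest p_def dist_norm)
  then have "(norm p)\<^sup>2 \<le> (norm (p - (k - x)))\<^sup>2" by (simp add: power_mono)
  then have "2 * (p \<bullet> (k - x)) \<le> (norm (k - x))\<^sup>2"
    by (simp only: power2_norm_eq_inner) (simp add: algebra_simps inner_commute)
  also have "\<dots> < \<tau> * c" using n2 \<tau> by (smt (verit) mult_strict_left_mono)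
  finally have "2 * (\<tau> * c + p \<bullet> q) < \<tau> * c"
    by (simp add: kx inner_add_right c_def)
  moreover have "- (p \<bullet> q) \<le> \<tau> * (c / 2)"
  proof -
    have "- (p \<bullet> q) \<le> norm p * norm q" using Cauchy_Schwarz_ineq2[of p q] by linarith
    also have "\<dots> \<le> norm p * (\<tau> * e)" using q by (simp add: mult_left_mono)
    also have "\<dots> = \<tau> * (norm p * e)" by simp
    also have "\<dots> \<le> \<tau> * (c / 2)" using pe \<tau>(1) by (intro mult_left_mono) auto
    finally show ?thesis .
  qed
  ultimately show False by simp
qed

lemma inner_closure_convex_hull_nonpos:
  fixes p :: "'a::euclidean_space"
  assumes "\<And>u. u \<in> C \<Longrightarrow> p \<bullet> u \<le> 0" "u \<in> closure (convex hull C)"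
  shows "p \<bullet> u \<le> 0"
proof -
  have "closure (convex hull C) \<subseteq> {u. p \<bullet> u \<le> 0}"
    using assms(1) by (intro closure_minimal hull_minimal closed_halfspace_le convex_halfspace_le) auto
  then show ?thesis using assms(2) by auto
qed

text \<open>If \<open>k\<close> is nearest to the point \<open>y\<close> of the ray, then
  \<open>p = y - k\<close> has nonpositive inner product with some \<open>u\<close> within
  \<open>e\<close> of \<open>v\<close>. So \<open>p \<bullet> v \<le> norm p * e\<close>, and to
  first order the distance grows at rate at most \<open>e\<close>; the gap between \<open>e\<close>
  and \<open>e'\<close> pays for the second-order term. The bound on \<open>h\<close> keeps nearest
  points within \<open>\<rho>\<close> of \<open>x\<close>.\<close>

lemma infdist_ray_le:
  fixes K :: "'a::euclidean_space set"
  assumes K: "closed K" "x \<in> K" and e: "0 \<le> e" "e < e'"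
    and near: "\<And>k. k \<in> K \<Longrightarrow> dist k x < \<rho> \<Longrightarrow>
      \<exists>u\<in>closure (convex hull (contingent_cone K k)). norm (v - u) \<le> e"
    and h: "0 \<le> h" "2 * h * norm v < \<rho>"
  shows "infdist (x + h *\<^sub>R v) K \<le> e' * h"
proof (rule field_le_epsilon)
  \<comment> \<open>The slack \<open>\<eta>\<close> keeps the bound \<open>q\<close> positive even
    where the distance vanishes, so that the step length \<open>d\<close> is positive.\<close>
  fix \<eta> :: real assume "\<eta> > 0"
  define g where "g = (\<lambda>\<tau>. infdist (x + \<tau> *\<^sub>R v) K)"
  have "g h \<le> e' * h + \<eta>"
  proof (rule real_closed_induct[OF h(1)])
    show "g 0 \<le> e' * 0 + \<eta>" using K \<open>\<eta> > 0\<close> by (simp add: g_def)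
  next
    fix f :: "nat \<Rightarrow> real" and t
    assume f: "\<And>n. 0 \<le> f n \<and> f n \<le> t \<and> g (f n) \<le> e' * f n + \<eta>" "f \<longlonglongrightarrow> t" "t \<le> h"
    have "(\<lambda>n. g (f n)) \<longlonglongrightarrow> g t" "(\<lambda>n. e' * f n + \<eta>) \<longlonglongrightarrow> e' * t + \<eta>"
      unfolding g_def by (intro tendsto_intros f)+
    then show "g t \<le> e' * t + \<eta>" using f by (intro LIMSEQ_le) auto
  next
    fix t assume t: "0 \<le> t" "t < h" "g t \<le> e' * t + \<eta>"
    define y where "y = x + t *\<^sub>R v"
    define q where "q = e' * t + \<eta>"
    have "q > 0" using t e \<open>\<eta> > 0\<close> by (simp add: q_def add_nonneg_pos)
    obtain k where k: "k \<in> K" "infdist y K = dist y k"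
      using infdist_attained K by (metis empty_iff)
    have "dist y k \<le> dist y x" using infdist_le[OF K(2), of y] k by simp
    then have "dist k x \<le> 2 * dist y x" by metric
    also have "\<dots> = 2 * t * norm v" using t by (simp add: y_def dist_norm)
    also have "\<dots> \<le> 2 * h * norm v" using t by (simp add: mult_right_mono)
    finally have "dist k x < \<rho>" using h by simp
    then obtain u where u: "u \<in> closure (convex hull (contingent_cone K k))" "norm (v - u) \<le> e"
      using near k by blast
    define p where "p = y - k"
    have gp: "g t = norm p" using k by (simp add: g_def p_def y_def dist_norm)
    have "p \<bullet> u \<le> 0"
      unfolding p_def
      by (rule inner_closure_convex_hull_nonpos[OF inner_contingent_cone_nonpos[OF K(1) k] u(1)])
    moreover have "p \<bullet> (v - u) \<le> norm p * e"
      using norm_cauchy_schwarz[of p "v - u"] u(2) mult_left_mono[OF u(2), of "norm p"] by simp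
    ultimately have "p \<bullet> v \<le> norm p * e" by (simp add: inner_diff_right)
    also have "\<dots> \<le> q * e" using gp t e by (intro mult_right_mono) (auto simp: q_def)
    finally have pv: "p \<bullet> v \<le> q * e" .
    \<comment> \<open>The second entry makes the quadratic term \<open>d * (norm v)\<^sup>2\<close>
      at most the slack \<open>2 * (e' - e) * q\<close>.\<close>
    define d where "d = min (h - t) (2 * (e' - e) * q / ((norm v)\<^sup>2 + 1))"
    have den: "(norm v)\<^sup>2 + 1 > 0" by (simp add: add_nonneg_pos)
    have "d > 0" using t e \<open>q > 0\<close> den by (simp add: d_def)
    have "d * ((norm v)\<^sup>2 + 1) \<le> 2 * (e' - e) * q"
      using den by (simp flip: pos_le_divide_eq add: d_def)
    then have dv: "d * (norm v)\<^sup>2 \<le> 2 * (e' - e) * q"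
      using \<open>d > 0\<close> by (simp add: algebra_simps)
    have "(g (t + d))\<^sup>2 \<le> (norm (p + d *\<^sub>R v))\<^sup>2"
    proof (rule power_mono)
      have "x + (t + d) *\<^sub>R v - k = p + d *\<^sub>R v" by (simp add: p_def y_def algebra_simps)
      then show "g (t + d) \<le> norm (p + d *\<^sub>R v)"
        using infdist_le[OF k(1), of "x + (t + d) *\<^sub>R v"] by (simp add: g_def dist_norm)
    qed (simp add: g_def infdist_nonneg)
    also have "\<dots> = (norm p)\<^sup>2 + d * (2 * (p \<bullet> v)) + d * (d * (norm v)\<^sup>2)"
      by (simp only: power2_norm_eq_inner) (simp add: algebra_simps inner_commute)
    also have "\<dots> \<le> q\<^sup>2 + d * (2 * (q * e)) + d * (2 * (e' - e) * q)"
      using pv dv \<open>d > 0\<close> gp t(3)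
      by (intro add_mono mult_left_mono power_mono) (auto simp: q_def)
    \<comment> \<open>The linear terms add up to \<open>2 * d * q * e'\<close>, so only the square
      \<open>(e' * d)\<^sup>2\<close> is dropped.\<close>
    also have "\<dots> \<le> (q + e' * d)\<^sup>2"
    proof -
      have "(q + e' * d)\<^sup>2 = q\<^sup>2 + d * (2 * (q * e)) + d * (2 * (e' - e) * q) + (e' * d)\<^sup>2"
        by (simp add: power2_eq_square algebra_simps)
      then show ?thesis by simp
    qed
    finally have "g (t + d) \<le> q + e' * d"
      using \<open>q > 0\<close> e \<open>d > 0\<close> by (auto dest: power2_le_imp_le)
    then have "g (t + d) \<le> e' * (t + d) + \<eta>" by (simp add: q_def algebra_simps)
    then show "\<exists>s>t. s \<le> h \<and> g s \<le> e' * s + \<eta>"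
      using \<open>d > 0\<close> by (intro exI[of _ "t + d"]) (auto simp: d_def)
  qed
  then show "infdist (x + h *\<^sub>R v) K \<le> e' * h + \<eta>" by (simp add: g_def)
qed

subsection \<open>Monotone majorants from Henstock's lemma\<close>

text \<open>A pair \<open>(t, s)\<close> encodes the interval from \<open>t\<close> to
  \<open>s\<close>, tagged at its left end. \<open>A\<close> will be fineness for a gauge, possibly
  with the tag restricted to a null set.\<close>

definition interval_chain :: "(real \<Rightarrow> real \<Rightarrow> bool) \<Rightarrow> real \<Rightarrow> real \<Rightarrow> (real \<times> real) set \<Rightarrow> bool" where
  "interval_chain A a b Q \<longleftrightarrow> finite Q \<and>
     (\<forall>(t, s)\<in>Q. a \<le> t \<and> t < s \<and> s \<le> b \<and> A t s) \<and>
     (\<forall>(t, s)\<in>Q. \<forall>(t', s')\<in>Q. (t, s) \<noteq> (t', s') \<longrightarrow> s \<le> t' \<or> s' \<le> t)"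

text \<open>Take for \<open>m t\<close> the supremum of the total weights of chains in
  \<open>{a..t}\<close>. Appending an admissible \<open>(t, s)\<close> to such a chain gives one in
  \<open>{a..s}\<close>, whence the increment inequality.\<close>

lemma exists_mono_dominating_increments:
  fixes \<omega> :: "real \<Rightarrow> real \<Rightarrow> real"
  assumes nonneg: "\<And>t s. \<omega> t s \<ge> 0"
    and bound: "\<And>Q. interval_chain A a b Q \<Longrightarrow> (\<Sum>(t, s)\<in>Q. \<omega> t s) \<le> c"
  obtains m where "mono_on {a..b} m" "\<And>t. t \<in> {a..b} \<Longrightarrow> 0 \<le> m t \<and> m t \<le> c"
    and "\<And>t s. a \<le> t \<Longrightarrow> t < s \<Longrightarrow> s \<le> b \<Longrightarrow> A t s \<Longrightarrow> \<omega> t s \<le> m s - m t"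
proof
  define S where "S = (\<lambda>t. (\<lambda>Q. \<Sum>(t, s)\<in>Q. \<omega> t s) ` {Q. interval_chain A a t Q})"
  define m where "m = (\<lambda>t. Sup (S t))"
  have zero: "0 \<in> S t" for t
    unfolding S_def by (rule image_eqI[of _ _ "{}"]) (auto simp: interval_chain_def)
  have chain_mono: "interval_chain A a s Q" if "interval_chain A a t Q" "t \<le> s" for t s Q
    using that unfolding interval_chain_def by fastforce
  have S_mono: "S t \<subseteq> S s" if "t \<le> s" for t s
    unfolding S_def using that chain_mono by blast
  have S_le: "x \<le> c" if "x \<in> S t" "t \<le> b" for x t
    using that bound chain_mono unfolding S_def by blast
  have bdd: "bdd_above (S t)" if "t \<le> b" for t
    using S_le that by (meson bdd_aboveI)
  show "mono_on {a..b} m"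
  proof (rule mono_onI)
    fix r s assume "r \<in> {a..b}" "s \<in> {a..b}" "r \<le> s"
    then show "m r \<le> m s"
      unfolding m_def using zero[of r] bdd S_mono by (intro cSup_subset_mono) auto
  qed
  show "0 \<le> m t \<and> m t \<le> c" if "t \<in> {a..b}" for t
    unfolding m_def using that S_le zero[of t] cSup_upper[OF zero bdd]
    by (auto intro!: cSup_least)
  fix t s assume ts: "a \<le> t" "t < s" "s \<le> b" "A t s"
  have "x \<le> m s - \<omega> t s" if "x \<in> S t" for x
  proof -
    from that obtain Q where Q: "interval_chain A a t Q" "x = (\<Sum>(t, s)\<in>Q. \<omega> t s)"
      by (auto simp: S_def)
    have "(t, s) \<notin> Q" using Q(1) ts(2) by (auto simp: interval_chain_def)
    then have "(\<Sum>(t, s)\<in>insert (t, s) Q. \<omega> t s) = x + \<omega> t s"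
      using Q by (simp add: interval_chain_def)
    moreover have "interval_chain A a s (insert (t, s) Q)"
      using Q(1) ts unfolding interval_chain_def by fastforce
    ultimately have "x + \<omega> t s \<in> S s"
      unfolding S_def by (metis (mono_tags, lifting) image_eqI mem_Collect_eq)
    then show ?thesis using cSup_upper[OF _ bdd[OF ts(3)]] by (fastforce simp: m_def)
  qed
  then have "m t \<le> m s - \<omega> t s"
    using zero[of t] unfolding m_def by (intro cSup_least) auto
  then show "\<omega> t s \<le> m s - m t" by simp
qed

text \<open>This makes Henstock's lemma and additivity of the integral available for chains;
  injectivity serves to reindex the sums over \<open>Q\<close>.\<close>

lemma interval_chain_tagged_partial_division:
  assumes "interval_chain A a b Q"
  shows "(\<lambda>(t, s). (t, {t..s})) ` Q tagged_partial_division_of {a..b}"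
    "(\<lambda>(t, s). {t..s}) ` Q division_of (\<Union>(t, s)\<in>Q. {t..s})"
    "inj_on (\<lambda>(t, s). (t, {t..s})) Q" "inj_on (\<lambda>(t, s). {t..s}) Q"
proof -
  note Q = assms[unfolded interval_chain_def]
  have less: "t < s" if "(t, s) \<in> Q" for t s using Q that by auto
  show *: "(\<lambda>(t, s). (t, {t..s})) ` Q tagged_partial_division_of {a..b}"
    unfolding tagged_partial_division_of_def
  proof (intro conjI allI impI)
    show "finite ((\<lambda>(t, s). (t, {t..s})) ` Q)" using Q by simp
  next
    fix x K assume "(x, K) \<in> (\<lambda>(t, s). (t, {t..s})) ` Q"
    then obtain s where "(x, s) \<in> Q" "K = {x..s}" by auto
    then show "x \<in> K" "K \<subseteq> {a..b}" "\<exists>a b. K = cbox a b" using Q by auto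
  next
    fix x1 K1 x2 K2
    assume *: "(x1, K1) \<in> (\<lambda>(t, s). (t, {t..s})) ` Q \<and> (x2, K2) \<in> (\<lambda>(t, s). (t, {t..s})) ` Q
      \<and> (x1, K1) \<noteq> (x2, K2)"
    then obtain s1 s2 where "(x1, s1) \<in> Q" "K1 = {x1..s1}" "(x2, s2) \<in> Q" "K2 = {x2..s2}"
      "(x1, s1) \<noteq> (x2, s2)" by auto
    moreover from this have "s1 \<le> x2 \<or> s2 \<le> x1" using Q by fast
    ultimately show "interior K1 \<inter> interior K2 = {}" by auto
  qed
  show "(\<lambda>(t, s). {t..s}) ` Q division_of (\<Union>(t, s)\<in>Q. {t..s})"
    using partial_division_of_tagged_division[OF *]
    by (simp add: image_image case_prod_unfold)
  show "inj_on (\<lambda>(t, s). (t, {t..s})) Q" "inj_on (\<lambda>(t, s). {t..s}) Q"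
    using less by (auto simp: inj_on_def Icc_eq_Icc) (meson not_less less_imp_le)+
qed

lemma Henstock_interval_chain:
  fixes f :: "real \<Rightarrow> real"
  assumes "f integrable_on {a..b}" "e > 0"
  obtains \<gamma> where "gauge \<gamma>"
    "\<And>Q. interval_chain (\<lambda>t s. {t..s} \<subseteq> \<gamma> t) a b Q \<Longrightarrow>
      (\<Sum>(t, s)\<in>Q. \<bar>(s - t) * f t - integral {t..s} f\<bar>) < e"
proof -
  obtain \<gamma> where \<gamma>: "gauge \<gamma>" "\<And>p. p tagged_partial_division_of {a..b} \<Longrightarrow> \<gamma> fine p \<Longrightarrow>
      (\<Sum>(x, k)\<in>p. norm (measure lborel k *\<^sub>R f x - integral k f)) < e"
    using Henstock_lemma[of f a b e] assms by auto
  show ?thesis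
  proof (rule that[OF \<gamma>(1)])
    fix Q assume Q: "interval_chain (\<lambda>t s. {t..s} \<subseteq> \<gamma> t) a b Q"
    have "\<gamma> fine (\<lambda>(t, s). (t, {t..s})) ` Q"
      using Q by (auto simp: fine_def interval_chain_def)
    from \<gamma>(2)[OF interval_chain_tagged_partial_division(1)[OF Q] this]
    have "(\<Sum>(t, s)\<in>Q. norm (measure lborel {t..s} *\<^sub>R f t - integral {t..s} f)) < e"
      by (subst (asm) sum.reindex[OF interval_chain_tagged_partial_division(3)[OF Q]])
        (simp add: case_prod_unfold)
    also have "(\<Sum>(t, s)\<in>Q. norm (measure lborel {t..s} *\<^sub>R f t - integral {t..s} f))
      = (\<Sum>(t, s)\<in>Q. \<bar>(s - t) * f t - integral {t..s} f\<bar>)"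
      using Q by (intro sum.cong) (auto simp: interval_chain_def)
    finally show "\<dots> < e" .
  qed
qed

lemma eventually_at_right_subset_gauge:
  fixes t :: real
  assumes "gauge \<gamma>"
  shows "\<forall>\<^sub>F s in at_right t. {t..s} \<subseteq> \<gamma> t"
proof -
  obtain r where "r > 0" "ball t r \<subseteq> \<gamma> t"
    using assms open_contains_ball unfolding gauge_def by metis
  then have "{t..s} \<subseteq> \<gamma> t" if "t < s" "s < t + r" for s
    using that by (force simp: dist_real_def)
  then show ?thesis
    using \<open>r > 0\<close> by (auto simp: eventually_at_right_field intro!: exI[of _ "t + r"])
qed

text \<open>
  A Perron majorant: the increment inequality holds at every point, so that no differentiation
  theorem for the integral of \<open>f\<close> is needed.
\<close>

lemma exists_mono_majorant:
  fixes f :: "real \<Rightarrow> real"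
  assumes "f integrable_on {a..b}" and nonneg: "\<And>t. t \<in> {a..b} \<Longrightarrow> 0 \<le> f t"
  obtains A c where "mono_on {a..b} A" "\<And>t. t \<in> {a..b} \<Longrightarrow> 0 \<le> A t \<and> A t \<le> c"
    and "\<And>t. a \<le> t \<Longrightarrow> t < b \<Longrightarrow> \<forall>\<^sub>F s in at_right t. f t * (s - t) \<le> A s - A t"
proof -
  \<comment> \<open>The tolerance 1 is arbitrary: it only enters the bound \<open>c\<close> of
    \<open>A\<close>.\<close>
  obtain \<gamma> where \<gamma>: "gauge \<gamma>" "\<And>Q. interval_chain (\<lambda>t s. {t..s} \<subseteq> \<gamma> t) a b Q \<Longrightarrow>
      (\<Sum>(t, s)\<in>Q. \<bar>(s - t) * f t - integral {t..s} f\<bar>) < 1"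
    using Henstock_interval_chain[OF assms(1), of 1] by auto
  \<comment> \<open>The absolute value makes \<open>\<omega>\<close> nonnegative for all arguments;
    on chains in \<open>{a..b}\<close> it changes nothing.\<close>
  define \<omega> where "\<omega> = (\<lambda>t s. \<bar>f t * (s - t)\<bar>)"
  have \<omega>_nonneg: "\<omega> t s \<ge> 0" for t s by (simp add: \<omega>_def)
  have bound: "(\<Sum>(t, s)\<in>Q. \<omega> t s) \<le> integral {a..b} f + 1"
    if Q: "interval_chain (\<lambda>t s. {t..s} \<subseteq> \<gamma> t) a b Q" for Q
  proof -
    let ?U = "\<Union>(t, s)\<in>Q. {t..s}"
    have sub: "a \<le> t \<and> t < s \<and> s \<le> b" if "(t, s) \<in> Q" for t s
      using Q that by (auto simp: interval_chain_def)
    note div = interval_chain_tagged_partial_division[OF Q]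
    have int: "f integrable_on {t..s}" if "(t, s) \<in> Q" for t s
      using sub[OF that] by (intro integrable_on_subinterval[OF assms(1)]) auto
    have "integral ?U f = (\<Sum>(t, s)\<in>Q. integral {t..s} f)"
      using int by (subst integral_combine_division_bottomup[OF div(2)])
        (auto simp: sum.reindex[OF div(4)] intro!: sum.cong)
    \<comment> \<open>As \<open>f\<close> is nonnegative, leaving out the gaps of the chain cannot
      increase the integral.\<close>
    moreover have "integral ?U f \<le> integral {a..b} f"
    proof (rule integral_subset_le)
      show "?U \<subseteq> {a..b}" using sub by fastforce
      show "f integrable_on ?U"
        using int by (intro integrable_combine_division[OF div(2)]) auto
    qed (use assms in auto)
    moreover have "(\<Sum>(t, s)\<in>Q. \<omega> t s) \<le>
        (\<Sum>(t, s)\<in>Q. \<bar>(s - t) * f t - integral {t..s} f\<bar> + integral {t..s} f)"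
    proof (intro sum_mono, clarify)
      fix t s assume "(t, s) \<in> Q"
      then have "\<omega> t s = (s - t) * f t"
        using sub nonneg by (force simp: \<omega>_def)
      then show "\<omega> t s \<le> \<bar>(s - t) * f t - integral {t..s} f\<bar> + integral {t..s} f" by linarith
    qed
    moreover have "\<dots> = (\<Sum>(t, s)\<in>Q. \<bar>(s - t) * f t - integral {t..s} f\<bar>)
        + (\<Sum>(t, s)\<in>Q. integral {t..s} f)"
      by (simp add: case_prod_unfold sum.distrib)
    ultimately show ?thesis using \<gamma>(2)[OF Q] by linarith
  qed
  show ?thesis
  proof (rule exists_mono_dominating_increments[OF \<omega>_nonneg bound])
    fix A assume A: "mono_on {a..b} A" "\<And>t. t \<in> {a..b} \<Longrightarrow> 0 \<le> A t \<and> A t \<le> integral {a..b} f + 1"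
      and inc: "\<And>t s. a \<le> t \<Longrightarrow> t < s \<Longrightarrow> s \<le> b \<Longrightarrow> {t..s} \<subseteq> \<gamma> t \<Longrightarrow> \<omega> t s \<le> A s - A t"
    show ?thesis
    proof (rule that[OF A])
      fix t assume t: "a \<le> t" "t < b"
      show "\<forall>\<^sub>F s in at_right t. f t * (s - t) \<le> A s - A t"
        using eventually_at_right_subset_gauge[OF \<gamma>(1), of t] eventually_at_right_less[of t]
          eventually_at_right_real[OF t(2)]
      proof eventually_elim
        case (elim s)
        then show ?case using inc[of t s] t unfolding \<omega>_def by fastforce
      qed
    qed
  qed
qed

text \<open>Henstock's lemma for the indicator of \<open>N\<close>, whose integral is 0, gives a
  gauge for which fine chains with tags in \<open>N\<close> have small total length. Absolute
  continuity then makes the total increment of \<open>z\<close> over such chains small, so the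
  supremum over chains is at most \<open>e\<close>.\<close>

lemma exists_small_mono_on_negligible:
  fixes z :: "real \<Rightarrow> 'a::real_normed_vector"
  assumes N: "negligible N" and ac: "abs_continuous_on {a..b} z" and "M \<ge> 0" "e > 0"
  obtains m where "mono_on {a..b} m" "\<And>t. t \<in> {a..b} \<Longrightarrow> 0 \<le> m t \<and> m t \<le> e"
    and "\<And>t. t \<in> N \<Longrightarrow> a \<le> t \<Longrightarrow> t < b \<Longrightarrow>
      \<forall>\<^sub>F s in at_right t. norm (z s - z t) + M * (s - t) \<le> m s - m t"
proof -
  have "e / 2 > 0" using \<open>e > 0\<close> by simp
  from ac[unfolded abs_continuous_on_def, THEN spec, THEN mp, OF this]
  obtain \<delta> where \<delta>: "\<delta> > 0" "\<forall>(n::nat) a' b'.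
      (\<forall>i<n. a' i \<le> b' i \<and> {a' i..b' i} \<subseteq> {a..b}) \<and>
      (\<forall>i<n. \<forall>j<n. i \<noteq> j \<longrightarrow> b' i \<le> a' j \<or> b' j \<le> a' i) \<and>
      (\<Sum>i<n. b' i - a' i) < \<delta> \<longrightarrow> (\<Sum>i<n. norm (z (b' i) - z (a' i))) < e / 2"
    by blast
  \<comment> \<open>The first entry triggers absolute continuity with \<open>e / 2\<close>; the
    second makes \<open>M\<close> times the total length at most \<open>e / 2\<close>.\<close>
  define \<eta> where "\<eta> = min \<delta> (e / (2 * (M + 1)))"
  have "\<eta> > 0" using \<delta> assms by (simp add: \<eta>_def)
  have ind: "((indicator N :: real \<Rightarrow> real) has_integral 0) {a'..b'}" for a' b'
    using N[unfolded negligible_def, THEN spec, THEN spec, of a' b'] by simp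
  obtain \<gamma> where \<gamma>: "gauge \<gamma>" "\<And>Q. interval_chain (\<lambda>t s. {t..s} \<subseteq> \<gamma> t) a b Q \<Longrightarrow>
      (\<Sum>(t, s)\<in>Q. \<bar>(s - t) * indicator N t - integral {t..s} (indicator N)\<bar>) < \<eta>"
    by (rule Henstock_interval_chain[OF has_integral_integrable[OF ind] \<open>\<eta> > 0\<close>]) blast
  define A where "A = (\<lambda>t s. {t..s} \<subseteq> \<gamma> t \<and> t \<in> N)"
  define \<omega> where "\<omega> = (\<lambda>t s. norm (z s - z t) + M * \<bar>s - t\<bar>)"
  have \<omega>_nonneg: "\<omega> t s \<ge> 0" for t s using \<open>M \<ge> 0\<close> by (simp add: \<omega>_def)
  have bound: "(\<Sum>(t, s)\<in>Q. \<omega> t s) \<le> e" if Q: "interval_chain A a b Q" for Q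
  proof -
    have sub: "a \<le> t \<and> t < s \<and> s \<le> b \<and> t \<in> N" if "(t, s) \<in> Q" for t s
      using Q that by (auto simp: interval_chain_def A_def)
    have "interval_chain (\<lambda>t s. {t..s} \<subseteq> \<gamma> t) a b Q"
      using Q by (auto simp: interval_chain_def A_def)
    from \<gamma>(2)[OF this]
    have "(\<Sum>(t, s)\<in>Q. \<bar>(s - t) * indicator N t - integral {t..s} (indicator N)\<bar>) < \<eta>" .
    \<comment> \<open>With all tags in \<open>N\<close>, the Henstock error of an interval is its
      length.\<close>
    also have "(\<Sum>(t, s)\<in>Q. \<bar>(s - t) * indicator N t - integral {t..s} (indicator N)\<bar>)
        = (\<Sum>(t, s)\<in>Q. \<bar>s - t\<bar>)"
      using sub integral_unique[OF ind] by (intro sum.cong) auto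
    finally have len: "(\<Sum>(t, s)\<in>Q. \<bar>s - t\<bar>) < \<eta>" .
    \<comment> \<open>Absolute continuity speaks of indexed families, so the chain is enumerated by
      \<open>h\<close>.\<close>
    have "finite Q" using Q by (simp add: interval_chain_def)
    then obtain h where h: "bij_betw h {..<card Q} Q"
      using ex_bij_betw_nat_finite by (metis atLeast0LessThan)
    have hQ: "(fst (h i), snd (h i)) \<in> Q" if "i < card Q" for i
      using bij_betwE[OF h] that by auto
    have "(\<Sum>i<card Q. norm (z (snd (h i)) - z (fst (h i)))) < e / 2"
    proof (intro \<delta>(2)[THEN spec, THEN spec, THEN spec, THEN mp] conjI allI impI)
      fix i assume "i < card Q"
      then show "fst (h i) \<le> snd (h i)" "{fst (h i)..snd (h i)} \<subseteq> {a..b}"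
        using sub[OF hQ] by force+
      fix j assume "j < card Q" "i \<noteq> j"
      then have "h i \<noteq> h j"
        using h \<open>i < card Q\<close> by (auto simp: bij_betw_def inj_on_def)
      then have "(fst (h i), snd (h i)) \<noteq> (fst (h j), snd (h j))" by simp
      then show "snd (h i) \<le> fst (h j) \<or> snd (h j) \<le> fst (h i)"
        using Q hQ[OF \<open>i < card Q\<close>] hQ[OF \<open>j < card Q\<close>] unfolding interval_chain_def by blast
    next
      have "(\<Sum>i<card Q. snd (h i) - fst (h i)) = (\<Sum>i<card Q. \<bar>snd (h i) - fst (h i)\<bar>)"
        using sub[OF hQ] by (intro sum.cong) force+
      also have "\<dots> = (\<Sum>(t, s)\<in>Q. \<bar>s - t\<bar>)"
        using sum.reindex_bij_betw[OF h, of "\<lambda>(t, s). \<bar>s - t\<bar>"] by (simp add: case_prod_unfold)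
      finally show "(\<Sum>i<card Q. snd (h i) - fst (h i)) < \<delta>"
        using len by (simp add: \<eta>_def)
    qed
    also have "(\<Sum>i<card Q. norm (z (snd (h i)) - z (fst (h i)))) = (\<Sum>(t, s)\<in>Q. norm (z s - z t))"
      using sum.reindex_bij_betw[OF h, of "\<lambda>(t, s). norm (z s - z t)"] by (simp add: case_prod_unfold)
    finally have 1: "(\<Sum>(t, s)\<in>Q. norm (z s - z t)) < e / 2" .
    have "M * (\<Sum>(t, s)\<in>Q. \<bar>s - t\<bar>) \<le> M * (e / (2 * (M + 1)))"
      using len \<open>M \<ge> 0\<close> by (intro mult_left_mono) (auto simp: \<eta>_def)
    also have "\<dots> \<le> e / 2" using \<open>M \<ge> 0\<close> \<open>e > 0\<close> by (simp add: field_simps)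
    finally show ?thesis
      using 1 by (simp add: \<omega>_def case_prod_unfold sum.distrib sum_distrib_left)
  qed
  show ?thesis
  proof (rule exists_mono_dominating_increments[OF \<omega>_nonneg bound])
    fix m assume m: "mono_on {a..b} m" "\<And>t. t \<in> {a..b} \<Longrightarrow> 0 \<le> m t \<and> m t \<le> e"
      and inc: "\<And>t s. a \<le> t \<Longrightarrow> t < s \<Longrightarrow> s \<le> b \<Longrightarrow> A t s \<Longrightarrow> \<omega> t s \<le> m s - m t"
    show ?thesis
    proof (rule that[OF m])
      fix t assume t: "t \<in> N" "a \<le> t" "t < b"
      show "\<forall>\<^sub>F s in at_right t. norm (z s - z t) + M * (s - t) \<le> m s - m t"
        using eventually_at_right_subset_gauge[OF \<gamma>(1), of t] eventually_at_right_less[of t]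
          eventually_at_right_real[OF t(3)]
      proof eventually_elim
        case (elim s)
        then show ?case using inc[of t s] t unfolding \<omega>_def A_def by fastforce
      qed
    qed
  qed
qed

subsection \<open>Moving inside the graph\<close>

lemma lsc_on_singleton_Times:
  fixes F :: "'a::topological_space \<Rightarrow> 'b::topological_space set" and c :: "'c::topological_space"
  assumes "lsc_on S F"
  shows "lsc_on S (\<lambda>x. {c} \<times> F x)"
  unfolding lsc_on_def
proof (intro allI impI)
  fix U :: "('c \<times> 'b) set" assume "open U"
  then have "open (Pair c -` U)"
    by (intro open_vimage continuous_intros)
  moreover have "{x \<in> S. ({c} \<times> F x) \<inter> U \<noteq> {}} = {x \<in> S. F x \<inter> Pair c -` U \<noteq> {}}"
    by auto
  ultimately show "openin (top_of_set S) {x \<in> S. ({c} \<times> F x) \<inter> U \<noteq> {}}"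
    using assms by (simp add: lsc_on_def)
qed

text \<open>The values may be unbounded, but the sets where \<open>F x\<close> meets the ball of
  radius \<open>n\<close> are relatively open and cover \<open>C\<close>; a finite subcover gives
  \<open>M\<close>.\<close>

lemma lsc_on_compact_bounded_selection:
  fixes F :: "'a::topological_space \<Rightarrow> 'b::real_normed_vector set"
  assumes "lsc_on S F" "compact C" "C \<subseteq> S" "\<And>x. x \<in> C \<Longrightarrow> F x \<noteq> {}"
  obtains M where "M \<ge> 0" "\<And>x. x \<in> C \<Longrightarrow> \<exists>v\<in>F x. norm v \<le> M"
proof -
  have "\<exists>O'. open O' \<and> {x \<in> S. F x \<inter> ball 0 (real n) \<noteq> {}} = S \<inter> O'" for n :: nat
    using assms(1) unfolding lsc_on_def openin_open by blast
  then obtain O' where O': "\<And>n. open (O' n)"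
      "\<And>n::nat. {x \<in> S. F x \<inter> ball 0 (real n) \<noteq> {}} = S \<inter> O' n"
    by metis
  have "C \<subseteq> (\<Union>n\<in>UNIV. O' n)"
  proof
    fix x assume "x \<in> C"
    then obtain v where "v \<in> F x" using assms(4) by blast
    moreover obtain n where "norm v < real n" using reals_Archimedean2 by blast
    ultimately have "x \<in> {x \<in> S. F x \<inter> ball 0 (real n) \<noteq> {}}"
      using \<open>x \<in> C\<close> assms(3) by auto
    then show "x \<in> (\<Union>n\<in>UNIV. O' n)" using O'(2) by blast
  qed
  then obtain I where I: "finite I" "C \<subseteq> (\<Union>n\<in>I. O' n)"
    using compactE_image[OF assms(2), of UNIV O'] O'(1) by metis
  obtain k where k: "\<And>n. n \<in> I \<Longrightarrow> n \<le> k"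
    using I(1) finite_nat_set_iff_bounded_le by metis
  have "\<exists>v\<in>F x. norm v \<le> real k" if x: "x \<in> C" for x
  proof -
    obtain n where "n \<in> I" "x \<in> S \<inter> O' n" using I(2) x assms(3) by blast
    then have "x \<in> {x \<in> S. F x \<inter> ball 0 (real n) \<noteq> {}}" using O'(2) by simp
    then obtain v where "v \<in> F x" "norm v < real n" by auto
    then show ?thesis using k[OF \<open>n \<in> I\<close>] by (intro bexI[of _ v]) auto
  qed
  then show ?thesis using that[of "real k"] by simp
qed

text \<open>By lower semicontinuity every \<open>F k\<close> with \<open>k\<close> near
  \<open>x\<close> contains a vector within \<open>e / 2\<close> of \<open>v\<close>, and near
  \<open>x\<close> on \<open>K\<close> this vector lies in the closed convex hull of the cone. So
  \<open>infdist_ray_le\<close> applies with \<open>e / 2 < e\<close>.\<close>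

lemma eventually_infdist_ray_le:
  fixes K :: "'a::euclidean_space set"
  assumes K: "closed K" "x \<in> K" and F: "lsc_on S F" "x \<in> S" "v \<in> F x"
    and "r > 0" and near: "\<And>k. k \<in> K \<Longrightarrow> dist k x < r \<Longrightarrow>
      k \<in> S \<and> F k \<subseteq> closure (convex hull (contingent_cone K k))"
    and "e > 0"
  shows "\<forall>\<^sub>F h in at_right 0. infdist (x + h *\<^sub>R v) K \<le> e * h"
proof -
  obtain O' where O': "open O'" "{k \<in> S. F k \<inter> ball v (e / 2) \<noteq> {}} = S \<inter> O'"
    using F(1) unfolding lsc_on_def openin_open by blast
  have "x \<in> {k \<in> S. F k \<inter> ball v (e / 2) \<noteq> {}}"
    using F \<open>e > 0\<close> by (force intro: centre_in_ball[THEN iffD2])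
  then have "x \<in> O'" using O'(2) by blast
  then obtain \<rho> where \<rho>: "\<rho> > 0" "ball x \<rho> \<subseteq> O'" using O'(1) open_contains_ball by blast
  have ray: "infdist (x + h *\<^sub>R v) K \<le> e * h" if "0 \<le> h" "2 * h * norm v < min r \<rho>" for h
  proof (rule infdist_ray_le[OF K _ _ _ that, of "e / 2"])
    fix k assume k: "k \<in> K" "dist k x < min r \<rho>"
    then have "k \<in> S \<inter> O'" using near \<rho>(2) by (force simp: dist_commute)
    then obtain u where "u \<in> F k" "dist v u < e / 2" using O'(2) by fastforce
    then show "\<exists>u\<in>closure (convex hull (contingent_cone K k)). norm (v - u) \<le> e / 2"
      using near[of k] k by (intro bexI[of _ u]) (auto simp: dist_norm)
  qed (use \<open>e > 0\<close> in auto)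
  have "((\<lambda>h. 2 * h * norm v) \<longlongrightarrow> 2 * 0 * norm v) (at_right 0)"
    by (intro tendsto_intros)
  then have "\<forall>\<^sub>F h in at_right 0. 2 * h * norm v < min r \<rho>"
    by (rule order_tendstoD) (use \<open>r > 0\<close> \<rho> in auto)
  with eventually_at_right_less[of "0::real"] show ?thesis
    by eventually_elim (simp add: ray)
qed

text \<open>Project \<open>(t + h, w + h *\<^sub>R v)\<close> to \<open>K\<close>. The time
  \<open>s\<close> of the projection may differ from \<open>t + h\<close>, but by at most
  \<open>h / 2\<close>, so time still advances and errors relative to \<open>h\<close> become errors
  relative to \<open>s - t\<close>.\<close>

lemma graph_step:
  fixes K :: "(real \<times> 'a::euclidean_space) set"
  assumes K: "closed K" "(t, w) \<in> K"
    and ray: "\<And>e. e > 0 \<Longrightarrow> \<forall>\<^sub>F h in at_right 0. infdist ((t, w) + h *\<^sub>R (1, v)) K \<le> e * h"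
    and "\<eta> > 0" "t < \<tau>"
  obtains s w' where "t < s" "s < \<tau>" "(s, w') \<in> K" "norm (w' - w - (s - t) *\<^sub>R v) \<le> \<eta> * (s - t)"
proof -
  have nv: "1 + norm v > 0" by (simp add: add_pos_nonneg)
  \<comment> \<open>The entry \<open>1 / 2\<close> gives \<open>s - t \<ge> h / 2\<close>; the other
    leaves a total error of at most \<open>\<eta> / 2 * h\<close>, hence at most
    \<open>\<eta> * (s - t)\<close>.\<close>
  define e where "e = min (1 / 2) (\<eta> / (2 * (1 + norm v)))"
  have e: "e > 0" "e \<le> 1 / 2"
    unfolding e_def using \<open>\<eta> > 0\<close> nv by (simp, intro min.cobounded1)
  have "e \<le> \<eta> / (2 * (1 + norm v))" by (simp add: e_def)
  then have e\<eta>: "e * (1 + norm v) \<le> \<eta> / 2" using nv by (simp add: pos_le_divide_eq algebra_simps)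
  \<comment> \<open>Since \<open>s \<le> t + 3 / 2 * h\<close>, this keeps \<open>s\<close> below
    \<open>\<tau>\<close>.\<close>
  have "\<forall>\<^sub>F h in at_right 0. h < (\<tau> - t) / 2"
    using \<open>t < \<tau>\<close> by (auto simp: eventually_at_right_field intro!: exI[of _ "(\<tau> - t) / 2"])
  with ray[OF e(1)] eventually_at_right_less[of "0::real"]
  have "\<forall>\<^sub>F h in at_right 0. 0 < h \<and> h < (\<tau> - t) / 2 \<and> infdist ((t, w) + h *\<^sub>R (1, v)) K \<le> e * h"
    by eventually_elim simp
  then obtain h where h: "0 < h" "h < (\<tau> - t) / 2" "infdist ((t, w) + h *\<^sub>R (1, v)) K \<le> e * h"
    using eventually_happens' trivial_limit_at_right_real by blast
  obtain s w' where sw: "(s, w') \<in> K"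
      "infdist ((t, w) + h *\<^sub>R (1, v)) K = dist ((t, w) + h *\<^sub>R (1, v)) (s, w')"
    using infdist_attained K by (metis empty_iff surj_pair)
  then have "dist (t + h, w + h *\<^sub>R v) (s, w') \<le> e * h" using h by simp
  then have d: "\<bar>t + h - s\<bar> \<le> e * h" "norm (w + h *\<^sub>R v - w') \<le> e * h"
    using dist_fst_le[of "(t + h, w + h *\<^sub>R v)" "(s, w')"]
      dist_snd_le[of "(t + h, w + h *\<^sub>R v)" "(s, w')"]
    by (auto simp: dist_real_def dist_norm)
  have "e * h \<le> h / 2" using e h mult_right_mono[of e "1 / 2" h] by simp
  then have "t + h - s \<le> h / 2" "s - t - h \<le> h / 2" using d(1) by linarith+
  then have s: "h / 2 \<le> s - t" "s < \<tau>" using h(1,2) by (simp_all add: field_simps)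
  have "w' - w - (s - t) *\<^sub>R v = - (w + h *\<^sub>R v - w') + (t + h - s) *\<^sub>R v"
    by (simp add: algebra_simps)
  also have "norm \<dots> \<le> norm (w + h *\<^sub>R v - w') + \<bar>t + h - s\<bar> * norm v"
    using norm_triangle_ineq[of "- (w + h *\<^sub>R v - w')" "(t + h - s) *\<^sub>R v"] by (simp add: norm_minus_commute)
  also have "\<dots> \<le> e * h + e * h * norm v"
    using d by (intro add_mono mult_right_mono) auto
  also have "\<dots> = e * (1 + norm v) * h" by (simp add: algebra_simps)
  also have "\<dots> \<le> \<eta> / 2 * h" using e\<eta> h by (intro mult_right_mono) auto
  also have "\<dots> = \<eta> * (h / 2)" by simp
  also have "\<dots> \<le> \<eta> * (s - t)" using s \<open>\<eta> > 0\<close> by (intro mult_left_mono) auto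
  finally show ?thesis using s h sw by (intro that[of s w']) auto
qed

text \<open>Closed induction on the existence of a point of \<open>K\<close> over \<open>t\<close>
  within \<open>B t\<close> of \<open>z t\<close>. For limits from the left, monotonicity bounds all
  earlier distances by \<open>B t\<close>; a convergent subsequence of the points and closedness of
  \<open>K\<close> give the limit point.\<close>

lemma graph_reach:
  fixes K :: "(real \<times> 'a::euclidean_space) set" and z :: "real \<Rightarrow> 'a"
  assumes "closed K" "a \<le> b" and z: "continuous_on {a..b} z" and mono: "mono_on {a..b} B"
    and "(a, z a) \<in> K" "0 \<le> B a"
    and step: "\<And>t w. a \<le> t \<Longrightarrow> t < b \<Longrightarrow> (t, w) \<in> K \<Longrightarrow> dist (z t) w \<le> B t \<Longrightarrow>
      \<exists>s w'. t < s \<and> s \<le> b \<and> (s, w') \<in> K \<and> dist (z s) w' \<le> B s"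
  shows "\<exists>w. (b, w) \<in> K \<and> dist (z b) w \<le> B b"
proof (rule real_closed_induct[OF \<open>a \<le> b\<close>])
  show "\<exists>w. (a, w) \<in> K \<and> dist (z a) w \<le> B a"
    using assms by (intro exI[of _ "z a"]) auto
  show "\<exists>s>t. s \<le> b \<and> (\<exists>w. (s, w) \<in> K \<and> dist (z s) w \<le> B s)"
    if "a \<le> t" "t < b" "\<exists>w. (t, w) \<in> K \<and> dist (z t) w \<le> B t" for t
    using step that by blast
next
  fix f :: "nat \<Rightarrow> real" and t
  assume f: "\<And>n. a \<le> f n \<and> f n \<le> t \<and> (\<exists>w. (f n, w) \<in> K \<and> dist (z (f n)) w \<le> B (f n))"
    and lim: "f \<longlonglongrightarrow> t" and "t \<le> b"
  have "a \<le> t" using f order_trans by blast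
  obtain w where w: "\<And>n. (f n, w n) \<in> K" "\<And>n. dist (z (f n)) (w n) \<le> B (f n)"
    using f by metis
  have "B (f n) \<le> B t" for n
    using f[of n] \<open>a \<le> t\<close> \<open>t \<le> b\<close> by (intro mono_onD[OF mono]) auto
  then have wB: "dist (z (f n)) (w n) \<le> B t" for n using w(2) order_trans by blast
  have zf: "(\<lambda>n. z (f n)) \<longlonglongrightarrow> z t"
    using f \<open>a \<le> t\<close> \<open>t \<le> b\<close>
    by (intro continuous_on_tendsto_compose[OF z lim]) (auto intro!: always_eventually intro: order_trans)
  then obtain r where r: "\<And>n. norm (z (f n)) \<le> r"
    using convergent_imp_Bseq convergentI BseqE by metis
  have "norm (w n) \<le> r + B t" for n
  proof -
    have "norm (w n) \<le> norm (z (f n)) + dist (z (f n)) (w n)"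
      using norm_triangle_sub[of "w n" "z (f n)"] by (simp add: dist_norm norm_minus_commute)
    then show ?thesis using r[of n] wB[of n] by linarith
  qed
  then have "bounded (range w)" by (auto intro: boundedI)
  then obtain l \<sigma> where l: "strict_mono \<sigma>" "(w \<circ> \<sigma>) \<longlonglongrightarrow> l"
    using bounded_imp_convergent_subsequence by blast
  have "(\<lambda>n. (f (\<sigma> n), w (\<sigma> n))) \<longlonglongrightarrow> (t, l)"
    using l LIMSEQ_subseq_LIMSEQ[OF lim l(1)] by (intro tendsto_Pair) (auto simp: o_def)
  then have "(t, l) \<in> K"
    using closed_sequentially[OF \<open>closed K\<close>, of "\<lambda>n. (f (\<sigma> n), w (\<sigma> n))"] w(1) by blast
  moreover have "(\<lambda>n. dist (z (f (\<sigma> n))) (w (\<sigma> n))) \<longlonglongrightarrow> dist (z t) l"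
    using l LIMSEQ_subseq_LIMSEQ[OF zf l(1)] by (intro tendsto_dist) (auto simp: o_def)
  then have "dist (z t) l \<le> B t"
    using wB by (intro LIMSEQ_le_const2) auto
  ultimately show "\<exists>w. (t, w) \<in> K \<and> dist (z t) w \<le> B t" by blast
qed

section \<open>Auxiliary facts on absolute continuity and norms\<close>

lemma abs_continuous_on_imp_continuous_on:
  assumes "abs_continuous_on {a..b} z"
  shows "continuous_on {a..b} z"
  unfolding continuous_on_iff
proof (intro ballI allI impI)
  fix x e :: real assume x: "x \<in> {a..b}" and "e > 0"
  from assms[unfolded abs_continuous_on_def, THEN spec, THEN mp, OF \<open>e > 0\<close>]
  obtain \<delta> where \<delta>: "\<delta> > 0" "\<forall>(n::nat) a' b'.
      (\<forall>i<n. a' i \<le> b' i \<and> {a' i..b' i} \<subseteq> {a..b}) \<and>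
      (\<forall>i<n. \<forall>j<n. i \<noteq> j \<longrightarrow> b' i \<le> a' j \<or> b' j \<le> a' i) \<and>
      (\<Sum>i<n. b' i - a' i) < \<delta> \<longrightarrow> (\<Sum>i<n. norm (z (b' i) - z (a' i))) < e"
    by blast
  have close: "norm (z q - z p) < e" if "p \<in> {a..b}" "q \<in> {a..b}" "p \<le> q" "q - p < \<delta>" for p q
    using \<delta>(2)[THEN spec[of _ 1], THEN spec[of _ "\<lambda>_. p"], THEN spec[of _ "\<lambda>_. q"]] that by auto
  show "\<exists>d>0. \<forall>y\<in>{a..b}. dist y x < d \<longrightarrow> dist (z y) (z x) < e"
  proof (intro exI[of _ \<delta>] conjI ballI impI \<delta>(1))
    fix y assume "y \<in> {a..b}" "dist y x < \<delta>"
    then show "dist (z y) (z x) < e"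
      using close[of x y] close[of y x] x
      by (cases "x \<le> y") (auto simp: dist_norm norm_minus_commute)
  qed
qed

lemma norm_add_diff_add_le:
  fixes a b c d :: "'a::real_normed_vector"
  shows "norm (a + b - c + d) \<le> norm a + norm b + norm c + norm d"
  by norm

text \<open>The two factors contribute at most 1 each to the squared norm. The crude bound 2 is the
  source of the factor in \<open>2 * k t\<close>.\<close>

lemma norm_le_2_cyl_box:
  assumes "v \<in> cyl_box j"
  shows "norm v \<le> 2"
proof -
  have "sqrt (\<Sum>i\<in>UNIV - {j}. (v $ i)\<^sup>2) \<le> 1" "\<bar>v $ j\<bar> \<le> 1"
    using assms by (auto simp: cyl_box_def)
  then have "(\<Sum>i\<in>UNIV - {j}. (v $ i)\<^sup>2) \<le> 1" "(v $ j)\<^sup>2 \<le> 1"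
    by (simp_all add: abs_square_le_1)
  moreover have "(norm v)\<^sup>2 = (v $ j)\<^sup>2 + (\<Sum>i\<in>UNIV - {j}. (v $ i)\<^sup>2)"
    by (simp add: norm_vec_def L2_set_def sum_nonneg sum.remove[of UNIV j])
  ultimately have "(norm v)\<^sup>2 \<le> 2\<^sup>2" by simp
  then show ?thesis by (rule power2_le_imp_le) simp
qed

subsection \<open>Invariance\<close>

theorem theorem4p14:
  fixes T :: real
    and E :: "real \<Rightarrow> real^'n \<Rightarrow> (real^'n) set"
    and P :: "real \<Rightarrow> (real^'n) set"
    and j :: 'n
  assumes E1: "\<And>t z. t \<in> {0..T} \<Longrightarrow> E t z \<noteq> {} \<and> closed (E t z) \<and> convex (E t z)"
    and E6_graph: "closed {((t, z), v). t \<in> {0..T} \<and> v \<in> E t z}"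
    and E6_lsc: "lsc_on ({0..T} \<times> UNIV) (\<lambda>(t, z). E t z)"
    and ELC: "\<And>R. R > 0 \<Longrightarrow> \<exists>k :: real \<Rightarrow> real.
                 k integrable_on {0..T} \<and> (\<forall>t\<in>{0..T}. k t \<ge> 0) \<and>
                 (\<forall>t\<in>{0..T}. \<forall>x\<in>cball 0 R. \<forall>y\<in>cball 0 R.
                    E t x \<subseteq> {a + b | a b. a \<in> E t y \<and> b \<in> (\<lambda>u. (k t * dist x y) *\<^sub>R u) ` cyl_box j})"
    and P_graph: "closed {(t, z). t \<in> {0..T} \<and> z \<in> P t}"
    and P_ne: "\<And>t. t \<in> {0..T} \<Longrightarrow> P t \<noteq> {}"
    and tangency: "\<And>t z. t \<in> {0<..<T} \<Longrightarrow> z \<in> P t \<Longrightarrow>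
        {1} \<times> E t z \<subseteq> closure (convex hull
           (contingent_cone {(s, w). s \<in> {0..T} \<and> w \<in> P s} (t, z)))"
  shows "\<forall>t0 \<in> {0<..<T}. \<forall>z0 \<in> P t0. \<forall>z :: real \<Rightarrow> real^'n.
           abs_continuous_on {t0..T} z \<and>
           (AE t in lebesgue. t \<in> {t0..T} \<longrightarrow>
               z differentiable (at t) \<and> vector_derivative z (at t) \<in> E t (z t)) \<and>
           z t0 = z0
           \<longrightarrow> (\<forall>t\<in>{t0..T}. z t \<in> P t)"
proof (intro ballI allI impI, elim conjE)
  fix t0 z0 and z :: "real \<Rightarrow> real^'n" and t1
  assume t0: "t0 \<in> {0<..<T}" and z0: "z0 \<in> P t0" "z t0 = z0" and ac: "abs_continuous_on {t0..T} z"
    and ae: "AE t in lebesgue. t \<in> {t0..T} \<longrightarrow>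
      z differentiable (at t) \<and> vector_derivative z (at t) \<in> E t (z t)"
    and t1: "t1 \<in> {t0..T}"
  define K where "K = {(s, w). s \<in> {0..T} \<and> w \<in> P s}"
  have "closed K" using P_graph by (simp add: K_def)
  have lsc: "lsc_on ({0..T} \<times> UNIV) (\<lambda>x. {1::real} \<times> (case x of (t, z) \<Rightarrow> E t z))"
    by (rule lsc_on_singleton_Times[OF E6_lsc])
  have ray: "\<forall>\<^sub>F h in at_right 0. infdist ((t, w) + h *\<^sub>R (1, v)) K \<le> e * h"
    if t: "t \<in> {0<..<T}" and w: "w \<in> P t" and v: "v \<in> E t w" and "e > 0" for t w v e
  proof (rule eventually_infdist_ray_le[OF \<open>closed K\<close> _ lsc _ _ _ _ \<open>e > 0\<close>])
    show "(t, w) \<in> K" "(t, w) \<in> {0..T} \<times> UNIV" using t w by (auto simp: K_def)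
    show "(1, v) \<in> {1::real} \<times> (case (t, w) of (t, z) \<Rightarrow> E t z)" using v by simp
    \<comment> \<open>Within this radius the times stay in the open interval, where tangency is
      assumed.\<close>
    show "min t (T - t) > 0" using t by simp
    fix k assume k: "k \<in> K" "dist k (t, w) < min t (T - t)"
    obtain s y where sy: "k = (s, y)" by (cases k)
    have "\<bar>s - t\<bar> < min t (T - t)"
      using k(2) dist_fst_le[of k "(t, w)"] by (simp add: sy dist_real_def)
    then have "s \<in> {0<..<T}" using t by (auto simp: abs_less_iff)
    then show "k \<in> {0..T} \<times> UNIV \<and> {1} \<times> (case k of (t, z) \<Rightarrow> E t z)
        \<subseteq> closure (convex hull (contingent_cone K k))"
      using tangency[of s y] k(1) by (auto simp: K_def sy)
  qed
  have cont: "continuous_on {t0..T} z"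
    using ac by (rule abs_continuous_on_imp_continuous_on)
  obtain R0 where R0: "\<And>t. t \<in> {t0..T} \<Longrightarrow> norm (z t) \<le> R0" "R0 > 0"
    using compact_imp_bounded[OF compact_continuous_image[OF cont compact_Icc]]
    unfolding bounded_pos by blast
  \<comment> \<open>The extra 1 makes room for points \<open>w\<close> of \<open>P t\<close> at
    distance at most 1 from \<open>z t\<close>.\<close>
  define R where "R = R0 + 1"
  have "R > 0" using R0 by (simp add: R_def)
  from ELC[OF \<open>R > 0\<close>] obtain k where k_int: "k integrable_on {0..T}"
    and k_nonneg: "\<forall>t\<in>{0..T}. k t \<ge> 0"
    and lip: "\<forall>t\<in>{0..T}. \<forall>x\<in>cball 0 R. \<forall>y\<in>cball 0 R.
      E t x \<subseteq> {a + b | a b. a \<in> E t y \<and> b \<in> (\<lambda>u. (k t * dist x y) *\<^sub>R u) ` cyl_box j}"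
    by (elim exE conjE)
  have "compact ({0..T} \<times> cball (0::real^'n) R)"
    by (intro compact_Times compact_Icc compact_cball)
  then obtain M where M: "M \<ge> 0" "\<And>x. x \<in> {0..T} \<times> cball 0 R \<Longrightarrow>
      \<exists>v\<in>(case x of (t, z) \<Rightarrow> E t z). norm v \<le> M"
    by (rule lsc_on_compact_bounded_selection[OF E6_lsc]) (use E1 in auto)
  obtain N where N: "negligible N" "\<And>t. t \<in> {t0..T} \<Longrightarrow> t \<notin> N \<Longrightarrow>
      z differentiable (at t) \<and> vector_derivative z (at t) \<in> E t (z t)"
    using ae unfolding eventually_ae_filter negligible_iff_null_sets by auto
  have "(\<lambda>t. 2 * k t) integrable_on {t0..T}"
    using integrable_on_subinterval[OF k_int, of t0 T] t0 by auto
  then obtain A c where A: "mono_on {t0..T} A" "\<And>t. t \<in> {t0..T} \<Longrightarrow> 0 \<le> A t \<and> A t \<le> c"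
    and A_inc: "\<And>t. t0 \<le> t \<Longrightarrow> t < T \<Longrightarrow> \<forall>\<^sub>F s in at_right t. 2 * k t * (s - t) \<le> A s - A t"
    by (rule exists_mono_majorant) (use k_nonneg t0 in auto)
  \<comment> \<open>The factor of \<open>e\<close> comes from \<open>A \<le> c\<close> and
    \<open>m \<le> e\<close>. The assumption \<open>small\<close> keeps the comparison points inside
    the ball of radius \<open>R\<close>.\<close>
  have approx: "\<exists>w\<in>P t1. dist (z t1) w \<le> e * (exp c * (T - t0 + 1))"
    if e: "e > 0" and small: "e * (exp c * (T - t0 + 1)) \<le> 1" for e
  proof -
    have "M + 1 \<ge> 0" using M by simp
    \<comment> \<open>In \<open>M + 1\<close>, \<open>M\<close> bounds the chosen velocity and 1 is
      the error rate allowed to \<open>graph_step\<close> at times in \<open>N\<close>.\<close>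
    obtain m where m: "mono_on {t0..T} m" "\<And>t. t \<in> {t0..T} \<Longrightarrow> 0 \<le> m t \<and> m t \<le> e"
      and m_inc: "\<And>t. t \<in> N \<Longrightarrow> t0 \<le> t \<Longrightarrow> t < T \<Longrightarrow>
        \<forall>\<^sub>F s in at_right t. norm (z s - z t) + (M + 1) * (s - t) \<le> m s - m t"
      using exists_small_mono_on_negligible[OF N(1) ac \<open>M + 1 \<ge> 0\<close> e] by blast
    define q where "q = (\<lambda>t. e * (t - t0) + m t)"
    define B where "B = (\<lambda>t. exp (A t) * q t)"
    have q_nonneg: "0 \<le> q t" if "t \<in> {t0..T}" for t
      using m(2)[OF that] e that by (simp add: q_def)
    have q_diff: "e * (s - t) \<le> q s - q t" "m s - m t \<le> q s - q t" "0 \<le> q s - q t"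
      if "t0 \<le> t" "t \<le> s" "s \<le> T" for s t
    proof -
      have "m t \<le> m s" using mono_onD[OF m(1), of t s] that by simp
      moreover have "0 \<le> e * (s - t)" using e that by simp
      ultimately show "e * (s - t) \<le> q s - q t" "m s - m t \<le> q s - q t" "0 \<le> q s - q t"
        unfolding q_def by (simp_all add: right_diff_distrib)
    qed
    have B_mono: "B t \<le> B s" if "t0 \<le> t" "t \<le> s" "s \<le> T" for s t
    proof -
      have "q t \<le> q s" using q_diff(3)[OF that] by simp
      then show ?thesis unfolding B_def
        using mono_onD[OF A(1), of t s] q_nonneg[of t] that by (intro mult_mono) auto
    qed
    have B_le: "B t \<le> e * (exp c * (T - t0 + 1))" if "t \<in> {t0..T}" for t
    proof -
      have "q t \<le> e * (T - t0 + 1)"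
      proof -
        have "e * (t - t0) \<le> e * (T - t0)" using e that by (intro mult_left_mono) auto
        then show ?thesis using m(2)[OF that] by (simp add: q_def distrib_left)
      qed
      then have "B t \<le> exp c * (e * (T - t0 + 1))"
        unfolding B_def using A(2)[OF that] q_nonneg[OF that] by (intro mult_mono) auto
      then show ?thesis by (simp add: mult_ac)
    qed
    have step: "\<exists>s w'. t < s \<and> s \<le> t1 \<and> (s, w') \<in> K \<and> dist (z s) w' \<le> B s"
      if t: "t0 \<le> t" "t < t1" and w: "(t, w) \<in> K" "dist (z t) w \<le> B t" for t w
    proof -
      \<comment> \<open>From \<open>t < t1 \<le> T\<close> the time \<open>t\<close> is interior, so
        \<open>ray\<close> applies; the endpoint \<open>T\<close> is only ever reached as a
        limit.\<close>
      have tT: "t \<in> {t0..T}" "t \<in> {0<..<T}" "t \<in> {0..T}" "w \<in> P t"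
        using t t0 t1 w by (auto simp: K_def)
      define r where "r = dist (z t) w"
      have "r \<le> 1" using w(2) B_le[OF tT(1)] small by (simp add: r_def)
      then have in_ball: "z t \<in> cball 0 R" "w \<in> cball 0 R"
        using R0(1)[OF tT(1)] norm_triangle_sub[of w "z t"]
        by (auto simp: R_def r_def dist_norm norm_minus_commute)
      have A0: "A t \<ge> 0" using A(2) tT(1) by simp
      show ?thesis
      proof (cases "t \<in> N")
        \<comment> \<open>Without information on the derivative, the whole increment of
          \<open>z\<close> and of the move is charged to \<open>m\<close>.\<close>
        case True
        obtain v where v: "v \<in> E t w" "norm v \<le> M" using M(2)[of "(t, w)"] in_ball tT by auto
        obtain \<tau> where \<tau>: "t < \<tau>" "\<And>s. t < s \<Longrightarrow> s < \<tau> \<Longrightarrow>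
            norm (z s - z t) + (M + 1) * (s - t) \<le> m s - m t"
          using m_inc[OF True] tT unfolding eventually_at_right_field by auto
        have "t < min \<tau> t1" using \<tau> t by simp
        from graph_step[OF \<open>closed K\<close> w(1) ray[OF tT(2,4) v(1)] zero_less_one this]
        obtain s w' where s: "t < s" "s < \<tau>" "s < t1" "(s, w') \<in> K"
            "norm (w' - w - (s - t) *\<^sub>R v) \<le> s - t"
          unfolding min_less_iff_conj mult_1 by blast
        have "z s - w' = (z s - z t) + (z t - w) - (w' - w - (s - t) *\<^sub>R v) + (t - s) *\<^sub>R v"
          by (simp add: algebra_simps)
        also have "norm \<dots> \<le> norm (z s - z t) + norm (z t - w) +
            norm (w' - w - (s - t) *\<^sub>R v) + norm ((t - s) *\<^sub>R v)"
          by (rule norm_add_diff_add_le)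
        also have "norm ((t - s) *\<^sub>R v) \<le> M * (s - t)"
          using v s by (simp add: mult.commute mult_left_mono)
        finally have "dist (z s) w' \<le> norm (z s - z t) + (M + 1) * (s - t) + r"
          using s(5) by (simp add: dist_norm r_def algebra_simps)
        also have "\<dots> \<le> r + (m s - m t)" using \<tau>(2)[OF s(1,2)] by simp
        also have "\<dots> \<le> r + (q s - q t)" using q_diff(2)[of t s] s t t1 by simp
        also have "\<dots> \<le> exp (A t) * q t + (q s - q t)" using w(2) by (simp add: r_def B_def)
        also have "\<dots> \<le> exp (A t) * q s"
        proof -
          have "1 * (q s - q t) \<le> exp (A t) * (q s - q t)"
            using A0 q_diff(3)[of t s] s t t1 by (intro mult_right_mono) auto
          then show ?thesis by (simp add: algebra_simps)
        qed
        also have "\<dots> \<le> B s"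
          unfolding B_def using mono_onD[OF A(1), of t s] q_nonneg[of s] s t t1
          by (intro mult_right_mono) auto
        finally show ?thesis using s by (intro exI[of _ s] exI[of _ w']) auto
      next
        case False
        define y where "y = vector_derivative z (at t)"
        have y: "y \<in> E t (z t)" and der: "(z has_vector_derivative y) (at t)"
          using N(2)[OF tT(1) False] by (auto simp: y_def vector_derivative_works)
        \<comment> \<open>The Lipschitz inclusion of \<open>E t (z t)\<close> in the enlarged
          \<open>E t w\<close> splits the derivative \<open>y\<close> into an admissible velocity
          \<open>v\<close> at \<open>w\<close> and a small rest.\<close>
        obtain v u where v: "v \<in> E t w" "u \<in> cyl_box j" "y = v + (k t * r) *\<^sub>R u"
          using bspec[OF bspec[OF bspec[OF lip tT(3)] in_ball(1)] in_ball(2)] y by (auto simp: r_def)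
        have yv: "norm (y - v) \<le> 2 * k t * r"
        proof -
          have "norm (y - v) = k t * r * norm u" using v(3) bspec[OF k_nonneg tT(3)] by (simp add: r_def)
          also have "\<dots> \<le> k t * r * 2"
            using norm_le_2_cyl_box[OF v(2)] bspec[OF k_nonneg tT(3)] by (intro mult_left_mono) (auto simp: r_def)
          finally show ?thesis by simp
        qed
        \<comment> \<open>One half of the rate \<open>e\<close> pays for the linearization of
          \<open>z\<close>, the other for \<open>graph_step\<close>; the term
          \<open>e * (t - t0)\<close> in \<open>q\<close> covers both.\<close>
        have "e / 2 > 0" using e by simp
        then obtain d where d: "d > 0" "\<And>s. \<bar>s - t\<bar> < d \<Longrightarrow>
            norm (z s - z t - (s - t) *\<^sub>R y) \<le> e / 2 * \<bar>s - t\<bar>"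
          using der unfolding has_vector_derivative_def has_derivative_at_alt real_norm_def by blast
        obtain \<tau> where \<tau>: "t < \<tau>" "\<And>s. t < s \<Longrightarrow> s < \<tau> \<Longrightarrow> 2 * k t * (s - t) \<le> A s - A t"
          using A_inc[of t] tT unfolding eventually_at_right_field by auto
        have "t < min (min \<tau> t1) (t + d)" using \<tau> t d by simp
        from graph_step[OF \<open>closed K\<close> w(1) ray[OF tT(2,4) v(1)] \<open>e / 2 > 0\<close> this]
        obtain s w' where s: "t < s" "s < \<tau>" "s < t1" "s < t + d" "(s, w') \<in> K"
            "norm (w' - w - (s - t) *\<^sub>R v) \<le> e / 2 * (s - t)"
          unfolding min_less_iff_conj by blast
        define h where "h = s - t"
        have h: "h > 0" "2 * k t * h \<le> A s - A t" "h * e \<le> q s - q t"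
          using s \<tau>(2) q_diff(1)[of t s] t t1 by (auto simp: h_def mult.commute)
        have "z s - w' = (z s - z t - h *\<^sub>R y) + (z t - w) - (w' - w - h *\<^sub>R v) + h *\<^sub>R (y - v)"
          by (simp add: algebra_simps)
        also have "norm \<dots> \<le> norm (z s - z t - h *\<^sub>R y) + norm (z t - w) +
            norm (w' - w - h *\<^sub>R v) + norm (h *\<^sub>R (y - v))"
          by (rule norm_add_diff_add_le)
        also have "norm (h *\<^sub>R (y - v)) \<le> h * (2 * k t * r)"
          using yv h by (simp add: mult_left_mono)
        also have "norm (z s - z t - h *\<^sub>R y) \<le> e / 2 * h"
          using d(2)[of s] s by (simp add: h_def)
        finally have "dist (z s) w' \<le> r + 2 * k t * h * r + h * e"
          using s(6) by (simp add: dist_norm r_def h_def[symmetric] algebra_simps)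
        also have "\<dots> = (1 + 2 * k t * h) * r + h * e" by (simp add: algebra_simps)
        also have "\<dots> \<le> (1 + 2 * k t * h) * B t + h * e"
          using w(2) bspec[OF k_nonneg tT(3)] h(1) by (intro add_mono mult_left_mono) (auto simp: r_def)
        \<comment> \<open>The Gronwall step: \<open>1 + x \<le> exp x\<close> turns the growth
          factor into the increment of \<open>A\<close> in the exponent.\<close>
        also have "\<dots> \<le> exp (A s - A t) * B t + (q s - q t)"
        proof (intro add_mono mult_right_mono h(3))
          show "1 + 2 * k t * h \<le> exp (A s - A t)"
            using h(2) exp_ge_add_one_self[of "A s - A t"] by linarith
          show "0 \<le> B t" using q_nonneg[OF tT(1)] by (simp add: B_def)
        qed
        also have "\<dots> = exp (A s) * q t + 1 * (q s - q t)"
          by (simp add: B_def exp_diff)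
        also have "\<dots> \<le> exp (A s) * q t + exp (A s) * (q s - q t)"
        proof -
          have "0 \<le> q s - q t" using q_diff(3)[of t s] s t t1 by simp
          moreover have "A s \<ge> 0" using A(2)[of s] s t t1 by simp
          ultimately show ?thesis by (intro add_left_mono mult_right_mono) auto
        qed
        also have "\<dots> = B s" by (simp add: B_def algebra_simps)
        finally show ?thesis using s by (intro exI[of _ s] exI[of _ w']) auto
      qed
    qed
    have "\<exists>w. (t1, w) \<in> K \<and> dist (z t1) w \<le> B t1"
    proof (rule graph_reach[OF \<open>closed K\<close> _ _ _ _ _ step])
      show "t0 \<le> t1" using t1 by simp
      show "continuous_on {t0..t1} z" using cont t1 by (auto intro: continuous_on_subset)
      show "mono_on {t0..t1} B" using B_mono t1 by (auto intro!: mono_onI)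
      show "(t0, z t0) \<in> K" using t0 z0 by (simp add: K_def)
      show "0 \<le> B t0" using q_nonneg[of t0] t0 by (simp add: B_def)
    qed
    then show ?thesis using B_le[OF t1] by (force simp: K_def)
  qed
  have "closed (P t1)"
  proof -
    have "P t1 = Pair t1 -` K" using t0 t1 by (auto simp: K_def)
    then show ?thesis using \<open>closed K\<close> by (simp add: closed_vimage continuous_on_Pair)
  qed
  moreover have "\<exists>w\<in>P t1. dist w (z t1) < \<epsilon>" if "\<epsilon> > 0" for \<epsilon>
  proof -
    define D where "D = exp c * (T - t0 + 1)"
    have "D > 0" using t0 by (simp add: D_def)
    \<comment> \<open>The entry 1 meets the smallness condition of \<open>approx\<close>;
      \<open>\<epsilon> / 2\<close> makes the resulting distance less than
      \<open>\<epsilon>\<close>.\<close>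
    define e where "e = min 1 (\<epsilon> / 2) / D"
    have "e > 0" "e * D \<le> 1" "e * D < \<epsilon>" using \<open>D > 0\<close> that by (auto simp: e_def)
    then show ?thesis using approx[of e] unfolding D_def[symmetric] by (force simp: dist_commute)
  qed
  ultimately show "z t1 \<in> P t1" using closed_approachable by blast
qed

end
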